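(* Let $p>1$, $A>0$ and $\sigma\ge 1$ be real numbers, and let $(f,g)\in C_0^2(\mathbf{R})\times C_0^1(\mathbf{R})$ be real-valued functions satisfying $\operatorname{supp}(f,g)\subset\{x\in\mathbf{R}: |x|\le\sigma\}$. Assume that either $$f(x)\ge 0,\ g(x)\ge 0 \ \text{ for all } x\in\mathbf{R},\ \text{ and } f\not\equiv 0,$$ or $$f(x)\ge 0,\ g(x)\ge 0 \ \text{ for all } x\in\mathbf{R},\ \text{ and } g\not\equiv 0.$$ Then there exist a constant $\varepsilon_0=\varepsilon_0(f,g,p,A,\sigma)>0$ and a constant $C>0$ independent of $\varepsilon$ such that, for every $\varepsilon$ with $0<\varepsilon\le\varepsilon_0$ and every $T$ satisfying $$T>C\varepsilon^{-(p-1)},$$ there exists no classical solution $v=v(x,t)$ in the time interval $[0,T]$ of the initial value problem $$\begin{cases} v_{tt}-v_{xx}=A|v_t|^{p-2}v_t\,v_{tt} & \text{in } \mathbf{R}\times(0,T),\\ v(x,0)=\varepsilon f(x),\quad v_t(x,0)=\varepsilon g(x), & x\in\mathbf{R}.\end{cases}$$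
   Context: $C_0^k(\mathbf{R})$ denotes the $C^k$ functions on $\mathbf{R}$ with compact support, and $\operatorname{supp}(f,g)\subset K$ means that both $f$ and $g$ vanish outside $K$. The unknown $v$ is a real-valued scalar function, and subscripts denote partial derivatives. A classical solution in the time interval $[0,T]$ is a function $v\in C^2(\mathbf{R}\times[0,T])$ satisfying the equation and the initial conditions pointwise. The expression $|s|^{p-2}s$ is understood as $0$ when $s=0$. The constant $C$ may depend on $f,g,p,A,\sigma$ but not on $\varepsilon$ or $T$. *)

theory Defs
  imports "HOL-Analysis.Analysis"
begin

primrec Ck_real :: "nat \<Rightarrow> (real \<Rightarrow> real) \<Rightarrow> bool" where
  "Ck_real 0 f \<longleftrightarrow> continuous_on UNIV f"
| "Ck_real (Suc k) f \<longleftrightarrow> (\<forall>x. f differentiable (at x)) \<and> Ck_real k (deriv f)"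

definition C0k_real :: "nat \<Rightarrow> (real \<Rightarrow> real) set" where
  "C0k_real k = {f. Ck_real k f \<and> compact (closure {x. f x \<noteq> 0})}"

definition dx :: "(real \<Rightarrow> real \<Rightarrow> real) \<Rightarrow> real \<Rightarrow> real \<Rightarrow> real" where
  "dx v x t = deriv (\<lambda>y. v y t) x"

text \<open>The time derivative is taken within \<open>[0,T]\<close>: one-sided at \<open>t = 0\<close> and \<open>t = T\<close>, the ordinary
  derivative for \<open>0 < t < T\<close>.\<close>

definition dt :: "real \<Rightarrow> (real \<Rightarrow> real \<Rightarrow> real) \<Rightarrow> real \<Rightarrow> real \<Rightarrow> real" where
  "dt T v x t = vector_derivative (\<lambda>s. v x s) (at t within {0..T})"

text \<open>The class \<open>C\<^sup>k(\<real> \<times> [0,T])\<close>: all partial derivatives up to order \<open>k\<close>, in every order of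
  differentiation, exist and are jointly continuous up to the boundary of the strip.
  Values of \<open>v\<close> outside the strip are irrelevant.\<close>

primrec Ck_strip :: "nat \<Rightarrow> real \<Rightarrow> (real \<Rightarrow> real \<Rightarrow> real) \<Rightarrow> bool" where
  "Ck_strip 0 T v \<longleftrightarrow> continuous_on (UNIV \<times> {0..T}) (\<lambda>(x, t). v x t)"
| "Ck_strip (Suc k) T v \<longleftrightarrow>
     continuous_on (UNIV \<times> {0..T}) (\<lambda>(x, t). v x t) \<and>
     (\<forall>x. \<forall>t\<in>{0..T}. (\<lambda>y. v y t) differentiable (at x)) \<and>
     (\<forall>x. \<forall>t\<in>{0..T}. (\<lambda>s. v x s) differentiable (at t within {0..T})) \<and>
     Ck_strip k T (dx v) \<and> Ck_strip k T (dt T v)"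

text \<open>Classical solutions on \<open>[0,T]\<close>, meant for \<open>T > 0\<close>, of
  \<open>v\<^sub>t\<^sub>t - v\<^sub>x\<^sub>x = A |v\<^sub>t|\<^bsup>p-2\<^esup> v\<^sub>t v\<^sub>t\<^sub>t\<close> with \<open>v(x,0) = \<phi>(x)\<close>, \<open>v\<^sub>t(x,0) = \<psi>(x)\<close>.
  The convention that \<open>|s|\<^bsup>p-2\<^esup> s\<close> is \<open>0\<close> at \<open>s = 0\<close> holds for the term below.\<close>

definition classical_solution ::
  "real \<Rightarrow> real \<Rightarrow> (real \<Rightarrow> real) \<Rightarrow> (real \<Rightarrow> real) \<Rightarrow> real \<Rightarrow> (real \<Rightarrow> real \<Rightarrow> real) \<Rightarrow> bool" where
  "classical_solution p A \<phi> \<psi> T v \<longleftrightarrow>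
     Ck_strip 2 T v \<and>
     (\<forall>x. \<forall>t\<in>{0<..<T}.
        dt T (dt T v) x t - dx (dx v) x t =
          A * (\<bar>dt T v x t\<bar> powr (p - 2) * dt T v x t) * dt T (dt T v) x t) \<and>
     (\<forall>x. v x 0 = \<phi> x \<and> dt T v x 0 = \<psi> x)"

end

theory Submission
  imports Defs
begin

text \<open>
  Put \<open>h = A \<bar>v\<^sub>t\<bar>\<^bsup>p\<^esup> / p\<close>; the equation reads \<open>(v\<^sub>t - h)\<^sub>t = v\<^sub>x\<^sub>x\<close>. A local energy estimate in cones
  of slope slightly larger than 1 shows that \<open>v\<close> vanishes for \<open>\<bar>x\<bar> > \<sigma> + t\<close>, so one may test with the
  weight \<open>exp (x - t)\<close>, which solves the linear wave equation. With \<open>F = \<integral> exp (x - t) v\<close> and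
  \<open>N = \<integral> exp (x - t) h\<close> this gives \<open>F' + 2 F = Z + \<integral>\<^sub>0\<^sup>t N + N\<close>, where \<open>Z\<close> is of size \<open>\<epsilon>\<close>. On the other
  hand \<open>F' + F = \<integral> exp (x - t) v\<^sub>t\<close> is bounded by a multiple of \<open>N\<^bsup>1/p\<^esup>\<close>, because the support bound makes
  the weight integrable uniformly in \<open>t\<close>. The two relations force blow-up at a time of order
  \<open>Z\<^bsup>1-p\<^esup>\<close>.
\<close>

section \<open>Differential inequalities and the blow-up time\<close>

text \<open>Derivatives are taken within an ambient set \<open>S\<close>, so that derivatives within
  \<open>{0..T}\<close>, one-sided at its ends, serve on every subinterval.\<close>

lemma nonneg_derivative_imp_le:
  fixes \<phi> :: "real \<Rightarrow> real"
  assumes "a \<le> b" and sub: "{a..b} \<subseteq> S"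
    and der: "\<And>t. t \<in> {a..b} \<Longrightarrow> (\<phi> has_real_derivative \<phi>' t) (at t within S)"
    and nonneg: "\<And>t. t \<in> {a..b} \<Longrightarrow> 0 \<le> \<phi>' t"
  shows "\<phi> a \<le> \<phi> b"
proof (rule DERIV_nonneg_imp_increasing_open[OF \<open>a \<le> b\<close>])
  have d: "(\<phi> has_real_derivative \<phi>' t) (at t within {a..b})" if "t \<in> {a..b}" for t
    using der[OF that] sub by (rule has_field_derivative_subset)
  show "\<exists>y. DERIV \<phi> x :> y \<and> 0 \<le> y" if "a < x" "x < b" for x
    using d[of x] nonneg[of x] that at_within_Icc_at[of a x b] by auto
  show "continuous_on {a..b} \<phi>"
    using d by (rule DERIV_continuous_on)
qed

text \<open>The integrating factor \<open>exp (k * t)\<close> turns the hypothesis on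
  \<open>\<phi>' + k \<phi>\<close> into the sign of a single derivative.\<close>

lemma exp_weighted_le:
  fixes \<phi> :: "real \<Rightarrow> real"
  assumes "a \<le> b" and sub: "{a..b} \<subseteq> S"
    and der: "\<And>t. t \<in> {a..b} \<Longrightarrow> (\<phi> has_real_derivative \<phi>' t) (at t within S)"
    and nonneg: "\<And>t. t \<in> {a..b} \<Longrightarrow> 0 \<le> \<phi>' t + k * \<phi> t"
  shows "exp (k * a) * \<phi> a \<le> exp (k * b) * \<phi> b"
proof (rule nonneg_derivative_imp_le[OF assms(1,2), where \<phi>' = "\<lambda>t. exp (k * t) * (\<phi>' t + k * \<phi> t)"])
  show "((\<lambda>t. exp (k * t) * \<phi> t) has_real_derivative exp (k * t) * (\<phi>' t + k * \<phi> t)) (at t within S)"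
    if "t \<in> {a..b}" for t
    by (rule derivative_eq_intros der[OF that] refl | simp add: algebra_simps)+
qed (use nonneg in simp)

text \<open>With \<open>L' = Y - L\<close> and \<open>P = Y - L\<close>, so that \<open>P' = N - P\<close>, choosing \<open>\<theta>\<close> proportional to \<open>F\<close>
  in the last hypothesis turns it into \<open>P \<ge> c F\<^bsup>p\<^esup>\<close>; since \<open>B = Z / 4 + L / 2 \<le> F\<close>, this is a
  Riccati-type inequality for \<open>B\<close>.\<close>

lemma blow_up_time:
  fixes F N Y :: "real \<Rightarrow> real"
  assumes p: "p > 1" and Z: "Z > 0" and D: "D > 0" and K: "K > 0"
    and F: "\<And>t. t \<in> {0..T} \<Longrightarrow> (F has_real_derivative Z + Y t + N t - 2 * F t) (at t within {0..T})"
    and Y: "\<And>t. t \<in> {0..T} \<Longrightarrow> (Y has_real_derivative N t) (at t within {0..T})"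
    and N: "\<And>t. t \<in> {0..T} \<Longrightarrow> 0 \<le> N t"
    and Y0: "Y 0 = 0" and F0: "0 \<le> F 0" "F 0 \<le> 2 * Z"
    and bound: "\<And>t \<theta>. t \<in> {0..T} \<Longrightarrow> \<theta> > 0 \<Longrightarrow>
                  Z + Y t + N t - F t \<le> \<theta> * D + \<theta> powr (1 - p) * K * N t"
  shows "T \<le> 4 + (Z / 4) powr (1 - p) * (4 * K * (4 * D) powr (p - 1)) / (p - 1)"
proof (cases "T \<le> 4")
  case True
  have "0 \<le> (Z / 4) powr (1 - p) * (4 * K * (4 * D) powr (p - 1)) / (p - 1)"
    using p K by simp
  with True show ?thesis by linarith
next
  case False
  then have T: "4 < T" by simp
  \<comment> \<open>The waiting time 4 makes the initial data negligible: from then on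
    \<open>exp (- t)\<close> is at most 1/32, so that \<open>exp (- t) * F 0\<close> is at most
    \<open>Z / 16\<close>.\<close>
  have "(5/2) ^ 4 \<le> exp (1::real) ^ 4"
    using exp_lower_Taylor_quadratic[of 1] by (intro power_mono) auto
  then have e4: "32 \<le> exp (4::real)"
    using exp_of_nat_mult[of 4 "1::real"] by (simp add: power_divide)
  have Ynn: "0 \<le> Y t" if "t \<in> {0..T}" for t
    using nonneg_derivative_imp_le[of 0 t "{0..T}" Y N] Y N Y0 that by auto
  \<comment> \<open>Integration by parts shows that \<open>Y - L\<close>, called \<open>P\<close>
    below, is the integral of \<open>exp (s - t) * N s\<close> over \<open>{0..t}\<close>; the
    present form uses no integral of \<open>N\<close>.\<close>
  define L where "L t = exp (- t) * integral {0..t} (\<lambda>s. exp s * Y s)" for t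
  have contY: "continuous_on {0..T} (\<lambda>s. exp s * Y s)"
    by (intro continuous_intros DERIV_continuous_on[OF Y])
  have L: "(L has_real_derivative Y t - L t) (at t within {0..T})" if "t \<in> {0..T}" for t
    unfolding L_def
    by (rule derivative_eq_intros integral_has_real_derivative[OF contY that] refl
        | simp add: exp_minus field_simps)+
  have L0: "L 0 = 0" by (simp add: L_def)
  have Lnn: "0 \<le> L t" if "t \<in> {0..T}" for t
    using exp_weighted_le[of 0 t "{0..T}" L "\<lambda>t. Y t - L t" 1] L L0 Ynn that
    by (auto simp: zero_le_mult_iff)
  define P where "P t = Y t - L t" for t
  have P: "(P has_real_derivative N t - P t) (at t within {0..T})" if "t \<in> {0..T}" for t
    unfolding P_def by (rule derivative_eq_intros Y L that refl | simp)+
  have Pnn: "0 \<le> P t" if "t \<in> {0..T}" for t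
    using exp_weighted_le[of 0 t "{0..T}" P "\<lambda>t. N t - P t" 1] P N that
    by (auto simp: zero_le_mult_iff P_def L0 Y0)
  \<comment> \<open>For \<open>G = F - Y / 2 - Z / 2\<close> one has
    \<open>G' + 2 G = N / 2 \<ge> 0\<close> and \<open>G 0 \<ge> - Z / 2\<close>; the factor
    \<open>exp (- 2 * t)\<close> shrinks this deficit below \<open>Z / 4\<close> once
    \<open>t \<ge> 4\<close>.\<close>
  have lower: "Z / 4 + Y t / 2 \<le> F t" if t: "t \<in> {4..T}" for t
  proof -
    have "exp (2 * 0) * (F 0 - Y 0 / 2 - Z / 2) \<le> exp (2 * t) * (F t - Y t / 2 - Z / 2)"
    proof (rule exp_weighted_le)
      show "((\<lambda>t. F t - Y t / 2 - Z / 2) has_real_derivative Z + Y s + N s - 2 * F s - N s / 2)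
              (at s within {0..T})" if "s \<in> {0..t}" for s
        using that t by (auto intro!: derivative_eq_intros F Y)
      show "0 \<le> Z + Y s + N s - 2 * F s - N s / 2 + 2 * (F s - Y s / 2 - Z / 2)"
        if "s \<in> {0..t}" for s
        using that t N[of s] by simp
    qed (use t in auto)
    then have 1: "- (Z / 2) \<le> exp (2 * t) * (F t - Y t / 2 - Z / 2)"
      using F0 Y0 by simp
    have "exp 4 \<le> exp (2 * t)" using t by simp
    then have "32 \<le> exp (2 * t)" using e4 by linarith
    then have "Z * 32 \<le> Z * exp (2 * t)" using Z by (intro mult_left_mono) auto
    then have "exp (2 * t) * (- (Z / 4)) \<le> - (Z / 2)" using Z by (simp add: mult.commute)
    with 1 have "exp (2 * t) * (- (Z / 4)) \<le> exp (2 * t) * (F t - Y t / 2 - Z / 2)" by linarith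
    then show ?thesis by (simp only: mult_le_cancel_left_pos exp_gt_zero)
  qed
  \<comment> \<open>For \<open>G = \<theta> D + \<kappa> P - F\<close> with fixed
    \<open>\<theta>\<close>, \<open>G' + G = \<theta> D + \<kappa> N - (F' + F)\<close>, which is
    nonnegative by \<open>bound\<close>.\<close>
  have upper: "F t \<le> \<theta> * D + \<theta> powr (1 - p) * K * P t + exp (- t) * F 0"
    if t: "t \<in> {0..T}" and \<theta>: "\<theta> > 0" for t \<theta>
  proof -
    define \<kappa> where "\<kappa> = \<theta> powr (1 - p) * K"
    have "exp (1 * 0) * (\<theta> * D + \<kappa> * P 0 - F 0) \<le> exp (1 * t) * (\<theta> * D + \<kappa> * P t - F t)"
    proof (rule exp_weighted_le)
      show "((\<lambda>t. \<theta> * D + \<kappa> * P t - F t) has_real_derivative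
              \<kappa> * (N s - P s) - (Z + Y s + N s - 2 * F s)) (at s within {0..T})"
        if "s \<in> {0..t}" for s
        using that t by (auto intro!: derivative_eq_intros F P)
      show "0 \<le> \<kappa> * (N s - P s) - (Z + Y s + N s - 2 * F s) + 1 * (\<theta> * D + \<kappa> * P s - F s)"
        if "s \<in> {0..t}" for s
        using that t bound[of s \<theta>] \<theta> by (simp add: \<kappa>_def algebra_simps)
    qed (use t in auto)
    moreover have "P 0 = 0" by (simp add: P_def L0 Y0)
    moreover have "0 < \<theta> * D" using \<theta> D by simp
    ultimately have "- F 0 \<le> exp t * (\<theta> * D + \<kappa> * P t - F t)" by simp
    then have "exp (- t) * - F 0 \<le> exp (- t) * (exp t * (\<theta> * D + \<kappa> * P t - F t))"
      by (intro mult_left_mono) auto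
    also have "\<dots> = \<theta> * D + \<kappa> * P t - F t" by (simp add: exp_minus)
    finally show ?thesis by (simp add: \<kappa>_def)
  qed
  define c where "c = 1 / (2 * K * (4 * D) powr (p - 1))"
  have c: "c > 0" using K D by (simp add: c_def)
  have PF: "c * F t powr p \<le> P t" if t: "t \<in> {4..T}" for t
  proof -
    have Fpos: "0 < F t" and FZ: "Z / 4 \<le> F t"
      using lower[OF t] Ynn[of t] Z t by auto
    \<comment> \<open>This choice makes \<open>\<theta> * D\<close> equal to \<open>F t / 4\<close>;
      the initial term is at most another quarter, so the term with \<open>P t\<close> is at least
      \<open>F t / 2\<close>.\<close>
    define \<theta> where "\<theta> = F t / (4 * D)"
    have \<theta>: "\<theta> > 0" using Fpos D by (simp add: \<theta>_def)
    have "exp 4 \<le> exp t" using t by simp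
    then have "32 \<le> exp t" using e4 by linarith
    then have "exp (- t) \<le> 1 / 32" by (simp add: exp_minus field_simps)
    then have "exp (- t) * F 0 \<le> 1 / 32 * (2 * Z)" using F0 by (intro mult_mono) auto
    then have "exp (- t) * F 0 \<le> F t / 4" using FZ by simp
    moreover have "\<theta> * D = F t / 4" using D by (simp add: \<theta>_def)
    ultimately have h: "F t / 2 \<le> \<theta> powr (1 - p) * K * P t"
      using upper[of t \<theta>] \<theta> t by auto
    have eq: "\<theta> powr (p - 1) * \<theta> powr (1 - p) = 1"
      using \<theta> by (simp add: powr_add[symmetric])
    have "\<theta> powr (p - 1) * (F t / 2) \<le> \<theta> powr (p - 1) * (\<theta> powr (1 - p) * K * P t)"
      using h by (intro mult_left_mono) auto
    also have "\<dots> = (\<theta> powr (p - 1) * \<theta> powr (1 - p)) * K * P t"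
      by (simp only: mult.assoc)
    also have "\<dots> = K * P t"
      using eq by simp
    finally have "\<theta> powr (p - 1) * F t / (2 * K) \<le> P t" using K by (simp add: field_simps)
    moreover have "\<theta> powr (p - 1) * F t = F t powr p / (4 * D) powr (p - 1)"
      using Fpos D by (simp add: \<theta>_def powr_divide powr_diff)
    ultimately have "F t powr p / (4 * D) powr (p - 1) / (2 * K) \<le> P t" by simp
    then show ?thesis by (simp add: c_def mult_ac)
  qed
  define B where "B t = Z / 4 + L t / 2" for t
  have Bpos: "Z / 4 \<le> B t" if "t \<in> {4..T}" for t
    using Lnn[of t] that by (simp add: B_def)
  have BF: "B t \<le> F t" if "t \<in> {4..T}" for t
    using lower[OF that] Pnn[of t] that by (simp add: B_def P_def)
  \<comment> \<open>Integrated form of \<open>B' \<ge> (c / 2) B^p\<close>: the quantity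
    \<open>- B powr (1 - p)\<close> is never positive but grows at rate at least
    \<open>(p - 1) * c / 2\<close>, which bounds the time.\<close>
  define \<Psi> where "\<Psi> t = - (B t powr (1 - p)) - (p - 1) * (c / 2) * t" for t
  have "\<Psi> 4 \<le> \<Psi> T"
  proof (rule nonneg_derivative_imp_le[where \<phi> = \<Psi> and a = 4 and b = T and S = "{0..T}"])
    show "(\<Psi> has_real_derivative (p - 1) * (B t powr (- p) * (P t / 2)) - (p - 1) * (c / 2))
            (at t within {0..T})" if t: "t \<in> {4..T}" for t
    proof -
      have B: "0 < B t" using Bpos[OF t] Z by linarith
      have Bd: "(B has_real_derivative P t / 2) (at t within {0..T})"
        unfolding B_def P_def using t by (auto intro!: derivative_eq_intros L)
      show ?thesis
        unfolding \<Psi>_def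
        by (rule derivative_eq_intros has_real_derivative_powr Bd DERIV_chain2[OF has_real_derivative_powr[OF B] Bd] refl
            | simp add: algebra_simps)+
    qed
    show "0 \<le> (p - 1) * (B t powr (- p) * (P t / 2)) - (p - 1) * (c / 2)" if t: "t \<in> {4..T}" for t
    proof -
      have B: "0 < B t" using Bpos[OF t] Z by linarith
      have "c = B t powr (- p) * (c * B t powr p)"
        using B by (simp add: powr_minus field_simps)
      also have "\<dots> \<le> B t powr (- p) * (c * F t powr p)"
        using B BF[OF t] p c by (intro mult_left_mono powr_mono2) auto
      also have "\<dots> \<le> B t powr (- p) * P t"
        using PF[OF t] by (intro mult_left_mono) auto
      finally have "(p - 1) * c \<le> (p - 1) * (B t powr (- p) * P t)"
        using p by (intro mult_left_mono) auto
      then show ?thesis by simp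
    qed
  qed (use T in auto)
  moreover have "B 4 powr (1 - p) \<le> (Z / 4) powr (1 - p)"
    using Bpos[of 4] T Z p by (intro powr_mono2') auto
  moreover have "0 \<le> B T powr (1 - p)" by simp
  ultimately have "(p - 1) * (c / 2) * T \<le> (p - 1) * (c / 2) * 4 + (Z / 4) powr (1 - p)"
    unfolding \<Psi>_def by linarith
  then have "(p - 1) * (c / 2) * (T - 4) \<le> (Z / 4) powr (1 - p)"
    by (simp only: right_diff_distrib)
  then have "T - 4 \<le> (Z / 4) powr (1 - p) / ((p - 1) * (c / 2))"
    using p c by (subst pos_le_divide_eq) (auto simp: mult.commute)
  also have "\<dots> = (Z / 4) powr (1 - p) * (4 * K * (4 * D) powr (p - 1)) / (p - 1)"
    by (simp add: c_def)
  finally show ?thesis by simp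
qed

section \<open>Powers of absolute values and the squared positive part\<close>

text \<open>Links the coefficient in the equation to the powers in \<open>energy\<close> and in
  \<open>h\<close>; it holds at \<open>s = 0\<close> as well because
  \<open>0 powr a = 0\<close>.\<close>

lemma abs_powr_split:
  fixes s p :: real
  shows "\<bar>s\<bar> powr p = \<bar>s\<bar> powr (p - 2) * s * s"
proof (cases "s = 0")
  case False
  then show ?thesis
    using powr_add[of "\<bar>s\<bar>" "p - 2" 2] by (simp add: power2_eq_square)
qed simp

text \<open>The modulus is \<open>\<bar>s\<bar> powr (p - 1)\<close> with a positive exponent, even
  when \<open>p < 2\<close> makes the first factor singular.\<close>

lemma abs_powr_mult_tendsto_0:
  fixes p :: real
  assumes "p > 1"
  shows "((\<lambda>s. \<bar>s\<bar> powr (p - 2) * s) \<longlongrightarrow> 0) (at 0)"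
proof (rule Lim_null_comparison)
  show "\<forall>\<^sub>F s in at 0. norm (\<bar>s\<bar> powr (p - 2) * s) \<le> \<bar>s\<bar> powr (p - 1)"
  proof (intro always_eventually allI)
    fix s :: real
    have "\<bar>s\<bar> powr (p - 2) * \<bar>s\<bar> = \<bar>s\<bar> powr (p - 1)" if "s \<noteq> 0"
      using that powr_add[of "\<bar>s\<bar>" "p - 2" 1] by simp
    then show "norm (\<bar>s\<bar> powr (p - 2) * s) \<le> \<bar>s\<bar> powr (p - 1)"
      by (cases "s = 0") (auto simp: abs_mult)
  qed
  have "((\<lambda>s::real. \<bar>s\<bar> powr (p - 1)) \<longlongrightarrow> \<bar>0\<bar> powr (p - 1)) (at 0)"
    using assms by (intro tendsto_powr' tendsto_intros) auto
  then show "((\<lambda>s::real. \<bar>s\<bar> powr (p - 1)) \<longlongrightarrow> 0) (at 0)" by simp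
qed

lemma continuous_on_abs_powr_mult:
  fixes p :: real
  assumes "p > 1"
  shows "continuous_on UNIV (\<lambda>s. \<bar>s\<bar> powr (p - 2) * s)"
proof (rule continuous_at_imp_continuous_on, rule ballI)
  fix s :: real
  show "isCont (\<lambda>s. \<bar>s\<bar> powr (p - 2) * s) s"
    using abs_powr_mult_tendsto_0[OF assms]
    by (cases "s = 0") (auto simp: isCont_def intro!: tendsto_intros)
qed

text \<open>Away from 0 the sign of \<open>s\<close> reduces this to the usual power rule; at 0 the
  difference quotient is \<open>\<bar>s\<bar> powr (p - 2) * s\<close> itself, which tends to
  0.\<close>

lemma has_real_derivative_abs_powr:
  fixes p s :: real
  assumes p: "p > 1"
  shows "((\<lambda>s. \<bar>s\<bar> powr p) has_real_derivative p * (\<bar>s\<bar> powr (p - 2) * s)) (at s)"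
proof -
  consider "s > 0" | "s < 0" | "s = 0" by linarith
  then show ?thesis
  proof cases
    case 1
    have "((\<lambda>s. s powr p) has_real_derivative p * s powr (p - 1)) (at s)"
      using 1 by (rule has_real_derivative_powr)
    moreover have "s powr (p - 1) = \<bar>s\<bar> powr (p - 2) * s"
      using 1 powr_add[of s "p - 2" 1] by simp
    ultimately have "((\<lambda>s. s powr p) has_real_derivative p * (\<bar>s\<bar> powr (p - 2) * s)) (at s)"
      by simp
    then show ?thesis
      by (rule has_field_derivative_transform_within_open[where S = "{0<..}"]) (use 1 in auto)
  next
    case 2
    have "((\<lambda>s. (- s) powr p) has_real_derivative p * (- s) powr (p - 1) * (- 1)) (at s)"
      using 2 by (intro DERIV_chain2[OF has_real_derivative_powr] derivative_intros) auto
    moreover have "(- s) powr (p - 1) * (- 1) = \<bar>s\<bar> powr (p - 2) * s"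
      using 2 powr_add[of "- s" "p - 2" 1] by simp
    ultimately have "((\<lambda>s. (- s) powr p) has_real_derivative p * (\<bar>s\<bar> powr (p - 2) * s)) (at s)"
      by (simp only: mult.assoc)
    then show ?thesis
      by (rule has_field_derivative_transform_within_open[where S = "{..<0}"]) (use 2 in auto)
  next
    case 3
    have "(\<lambda>s. \<bar>s\<bar> powr (p - 2) * s) = (\<lambda>s. (\<bar>s\<bar> powr p - \<bar>0\<bar> powr p) / (s - 0))"
    proof
      fix s :: real
      show "\<bar>s\<bar> powr (p - 2) * s = (\<bar>s\<bar> powr p - \<bar>0\<bar> powr p) / (s - 0)"
        using p by (cases "s = 0") (auto simp: abs_powr_split[of s p])
    qed
    with abs_powr_mult_tendsto_0[OF p] 3 show ?thesis
      by (simp add: has_field_derivative_iff)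
  qed
qed

lemma has_real_derivative_abs_powr_mult:
  fixes p s :: real
  assumes p: "p > 1"
  shows "((\<lambda>s. \<bar>s\<bar> powr p * s) has_real_derivative (p + 1) * \<bar>s\<bar> powr p) (at s)"
  by (rule derivative_eq_intros has_real_derivative_abs_powr[OF p] refl
      | simp add: abs_powr_split[of s p] algebra_simps)+

text \<open>Squaring removes the corner of the positive part at 0, where the difference quotient is
  now bounded by \<open>\<bar>y\<bar>\<close>. This serves to differentiate the cutoff to a
  cone.\<close>

lemma has_real_derivative_max_0_power2:
  fixes z :: real
  shows "((\<lambda>z. (max 0 z)\<^sup>2) has_real_derivative 2 * max 0 z) (at z)"
proof -
  consider "z > 0" | "z < 0" | "z = 0" by linarith
  then show ?thesis
  proof cases
    case 1
    have "((\<lambda>z. z\<^sup>2) has_real_derivative 2 * max 0 z) (at z)"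
      using 1 by (auto intro!: derivative_eq_intros)
    then show ?thesis
      by (rule has_field_derivative_transform_within_open[where S = "{0<..}"]) (use 1 in auto)
  next
    case 2
    have "((\<lambda>z. 0) has_real_derivative 2 * max 0 z) (at z)"
      using 2 by (auto intro!: derivative_eq_intros)
    then show ?thesis
      by (rule has_field_derivative_transform_within_open[where S = "{..<0}"]) (use 2 in auto)
  next
    case 3
    have "((\<lambda>y::real. (max 0 y)\<^sup>2 / y) \<longlongrightarrow> 0) (at 0)"
    proof (rule Lim_null_comparison)
      show "\<forall>\<^sub>F y in at 0. norm ((max 0 y)\<^sup>2 / y) \<le> \<bar>y::real\<bar>"
        by (intro always_eventually allI) (auto simp: max_def power2_eq_square)
    qed (auto intro!: tendsto_eq_intros)
    then show ?thesis using 3 by (simp add: has_field_derivative_iff)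
  qed
qed

text \<open>A substitute for Hoelder's inequality: beyond \<open>\<theta>\<close>, write
  \<open>x = x powr (1 - p) * x powr p\<close> and use that \<open>1 - p\<close> is negative. The
  parameter \<open>\<theta>\<close> is chosen only after integration.\<close>

lemma le_add_powr_mult:
  fixes p \<theta> x :: real
  assumes p: "p > 1" and \<theta>: "\<theta> > 0"
  shows "x \<le> \<theta> + \<theta> powr (1 - p) * \<bar>x\<bar> powr p"
proof (cases "x \<le> \<theta>")
  case True
  have "0 \<le> \<theta> powr (1 - p) * \<bar>x\<bar> powr p" by simp
  with True show ?thesis by linarith
next
  case False
  then have x: "0 < x" using \<theta> by simp
  then have "x = x powr (1 - p) * x powr p"
    by (simp add: powr_add[symmetric])
  also have "\<dots> \<le> \<theta> powr (1 - p) * x powr p"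
    using False \<theta> p by (intro mult_right_mono powr_mono2') auto
  finally show ?thesis using x \<theta> by simp
qed

section \<open>Leibniz rule and mixed partial derivatives on the strip\<close>

text \<open>The parameter set is kept general: it is \<open>{0..T}\<close> for derivatives in time
  and \<open>UNIV\<close> for derivatives in space.\<close>

lemma has_real_derivative_slice_integral:
  fixes w w' :: "real \<Rightarrow> real \<Rightarrow> real"
  assumes "\<And>x t. x \<in> {a..b} \<Longrightarrow> t \<in> S \<Longrightarrow> (w x has_real_derivative w' x t) (at t within S)"
    and "\<And>t. t \<in> S \<Longrightarrow> continuous_on {a..b} (\<lambda>x. w x t)"
    and "continuous_on ({a..b} \<times> S) (\<lambda>(x, t). w' x t)"
    and "t \<in> S" "convex S"
  shows "((\<lambda>t. integral {a..b} (\<lambda>x. w x t)) has_real_derivative integral {a..b} (\<lambda>x. w' x t))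
           (at t within S)"
proof -
  have "continuous_on (S \<times> {a..b}) (\<lambda>(t, x). w' x t)"
    using continuous_on_compose2[OF assms(3), of "S \<times> {a..b}" "\<lambda>(t, x). (x, t)"]
    by (force simp: split_beta intro!: continuous_intros)
  then show ?thesis
    using leibniz_rule_field_derivative[of S a b "\<lambda>t x. w x t" "\<lambda>t x. w' x t" t] assms
    by (auto simp: integrable_continuous_real)
qed

lemma continuous_on_strip_compose:
  fixes w :: "real \<Rightarrow> real \<Rightarrow> real"
  assumes "continuous_on (UNIV \<times> {0..T}) (\<lambda>(x, t). w x t)"
    and "continuous_on X f" "continuous_on X g" "\<And>z. z \<in> X \<Longrightarrow> g z \<in> {0..T}"
  shows "continuous_on X (\<lambda>z. w (f z) (g z))"
  using continuous_on_compose2[OF assms(1) continuous_on_Pair[OF assms(2,3)]] assms(4)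
  by (simp add: image_subset_iff)

lemma has_real_derivative_unique_Icc:
  fixes \<phi> :: "real \<Rightarrow> real"
  assumes "a < b" "t \<in> {a..b}"
    and "(\<phi> has_real_derivative d) (at t within {a..b})"
    and "(\<phi> has_real_derivative d') (at t within {a..b})"
  shows "d = d'"
  using assms vector_derivative_within_closed_interval[of a b t \<phi>]
  by (metis has_real_derivative_iff_has_vector_derivative)

text \<open>Differentiating \<open>v y s - v y 0 = integral {0..s} (vt y)\<close> in
  \<open>y\<close> gives \<open>integral {0..s} (vtx x) = vx x s - vx x 0\<close>; differentiating
  that in \<open>s\<close> gives the claim, also at the ends of the time interval.\<close>

lemma mixed_partials_eq:
  fixes v vt vx vtx vxt :: "real \<Rightarrow> real \<Rightarrow> real"
  assumes T: "T > 0" and t: "t \<in> {0..T}"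
    and v_t: "\<And>x t. t \<in> {0..T} \<Longrightarrow> (v x has_real_derivative vt x t) (at t within {0..T})"
    and v_x: "\<And>x t. t \<in> {0..T} \<Longrightarrow> ((\<lambda>y. v y t) has_real_derivative vx x t) (at x)"
    and vt_x: "\<And>x t. t \<in> {0..T} \<Longrightarrow> ((\<lambda>y. vt y t) has_real_derivative vtx x t) (at x)"
    and vx_t: "\<And>x t. t \<in> {0..T} \<Longrightarrow> (vx x has_real_derivative vxt x t) (at t within {0..T})"
    and cont_vt: "continuous_on (UNIV \<times> {0..T}) (\<lambda>(x, t). vt x t)"
    and cont_vtx: "continuous_on (UNIV \<times> {0..T}) (\<lambda>(x, t). vtx x t)"
  shows "vtx x t = vxt x t"
proof -
  have I: "integral {0..s} (vtx x) = vx x s - vx x 0" if s: "s \<in> {0..T}" for s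
  proof -
    have "((\<lambda>y. integral {0..s} (vt y)) has_real_derivative integral {0..s} (vtx x)) (at x)"
    proof (rule has_real_derivative_slice_integral[of 0 s UNIV "\<lambda>r y. vt y r" "\<lambda>r y. vtx y r"])
      show "continuous_on {0..s} (\<lambda>r. vt y r)" for y
        by (rule continuous_on_strip_compose[OF cont_vt]) (use s in \<open>auto intro: continuous_intros\<close>)
      show "continuous_on ({0..s} \<times> UNIV) (\<lambda>(r, y). vtx y r)"
        unfolding split_beta
        by (rule continuous_on_strip_compose[OF cont_vtx]) (use s in \<open>auto intro: continuous_intros\<close>)
    qed (use s vt_x in auto)
    moreover have "integral {0..s} (vt y) = v y s - v y 0" for y
    proof (rule integral_unique, rule fundamental_theorem_of_calculus)
      show "(v y has_vector_derivative vt y r) (at r within {0..s})" if "r \<in> {0..s}" for r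
        using v_t[of r y] s that
        by (auto simp: has_real_derivative_iff_has_vector_derivative[symmetric]
            intro: has_field_derivative_subset)
    qed (use s in auto)
    ultimately have "((\<lambda>y. v y s - v y 0) has_real_derivative integral {0..s} (vtx x)) (at x)"
      by simp
    moreover have "((\<lambda>y. v y s - v y 0) has_real_derivative vx x s - vx x 0) (at x)"
      using s T by (intro derivative_intros v_x) auto
    ultimately show ?thesis by (rule DERIV_unique)
  qed
  have "continuous_on {0..T} (vtx x)"
    by (rule continuous_on_strip_compose[OF cont_vtx]) (auto intro: continuous_intros)
  then have "((\<lambda>s. integral {0..s} (vtx x)) has_real_derivative vtx x t) (at t within {0..T})"
    using t by (rule integral_has_real_derivative)
  then have "((\<lambda>s. vx x s - vx x 0) has_real_derivative vtx x t) (at t within {0..T})"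
    by (rule has_field_derivative_transform_within[OF _ zero_less_one t]) (simp add: I)
  moreover have "((\<lambda>s. vx x s - vx x 0) has_real_derivative vxt x t) (at t within {0..T})"
    using vx_t[OF t] by (auto intro!: derivative_eq_intros)
  ultimately show ?thesis
    using has_real_derivative_unique_Icc T t by blast
qed

section \<open>Solutions on the strip and finite speed of propagation\<close>

text \<open>The partial derivatives are parameters tied to \<open>v\<close> by derivative facts, so
  that no computation handles \<open>deriv\<close> or \<open>vector_derivative\<close>. The single
  function \<open>vxt\<close> stands for both mixed derivatives.\<close>

locale strip_wave =
  fixes p A T :: real and v vt vx vtt vxx vxt :: "real \<Rightarrow> real \<Rightarrow> real"
  assumes p: "p > 1" and A: "A > 0" and T: "T > 0"
    and cont_v: "continuous_on (UNIV \<times> {0..T}) (\<lambda>(x, t). v x t)"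
    and cont_vt: "continuous_on (UNIV \<times> {0..T}) (\<lambda>(x, t). vt x t)"
    and cont_vx: "continuous_on (UNIV \<times> {0..T}) (\<lambda>(x, t). vx x t)"
    and cont_vxx: "continuous_on (UNIV \<times> {0..T}) (\<lambda>(x, t). vxx x t)"
    and cont_vxt: "continuous_on (UNIV \<times> {0..T}) (\<lambda>(x, t). vxt x t)"
    and v_t: "\<And>x t. t \<in> {0..T} \<Longrightarrow> (v x has_real_derivative vt x t) (at t within {0..T})"
    and v_x: "\<And>x t. t \<in> {0..T} \<Longrightarrow> ((\<lambda>y. v y t) has_real_derivative vx x t) (at x)"
    and vt_t: "\<And>x t. t \<in> {0..T} \<Longrightarrow> (vt x has_real_derivative vtt x t) (at t within {0..T})"
    and vx_x: "\<And>x t. t \<in> {0..T} \<Longrightarrow> ((\<lambda>y. vx y t) has_real_derivative vxx x t) (at x)"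
    and vt_x: "\<And>x t. t \<in> {0..T} \<Longrightarrow> ((\<lambda>y. vt y t) has_real_derivative vxt x t) (at x)"
    and vx_t: "\<And>x t. t \<in> {0..T} \<Longrightarrow> (vx x has_real_derivative vxt x t) (at t within {0..T})"
    and wave_eq: "\<And>x t. t \<in> {0..T} \<Longrightarrow>
      vtt x t - vxx x t = A * (\<bar>vt x t\<bar> powr (p - 2) * vt x t) * vtt x t"
begin

lemmas cont_strip =
  continuous_on_strip_compose[OF cont_v] continuous_on_strip_compose[OF cont_vt]
  continuous_on_strip_compose[OF cont_vx] continuous_on_strip_compose[OF cont_vxx]
  continuous_on_strip_compose[OF cont_vxt]

text \<open>The density conserved by the nonlinear equation: its time derivative is \<open>(v\<^sub>t v\<^sub>x)\<^sub>x\<close>.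
  It controls the flux \<open>\<bar>v\<^sub>t v\<^sub>x\<bar>\<close> only where \<open>v\<^sub>t\<close> is small.\<close>

definition energy :: "real \<Rightarrow> real \<Rightarrow> real" where
  "energy x t = (vt x t)\<^sup>2 / 2 - A / (p + 1) * (\<bar>vt x t\<bar> powr p * vt x t) + (vx x t)\<^sup>2 / 2"

text \<open>The equation times \<open>vt\<close> gives
  \<open>vt vxx = vt vtt - A \<bar>vt\<bar>^p vtt\<close>, whose right-hand side is the time
  derivative of the first two terms of \<open>energy\<close>.\<close>

lemma energy_t:
  assumes t: "t \<in> {0..T}"
  shows "(energy x has_real_derivative vt x t * vxx x t + vx x t * vxt x t) (at t within {0..T})"
proof -
  have d: "(energy x has_real_derivative
      vt x t * vtt x t - A / (p + 1) * ((p + 1) * \<bar>vt x t\<bar> powr p * vtt x t) + vx x t * vxt x t)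
      (at t within {0..T})"
    unfolding energy_def
    by (rule derivative_eq_intros v_t vx_t vt_t t
          DERIV_chain2[OF has_real_derivative_abs_powr_mult[OF p]] refl | simp)+
  have "vxx x t = vtt x t - A * (\<bar>vt x t\<bar> powr (p - 2) * vt x t) * vtt x t"
    using wave_eq[OF t, of x] by linarith
  then have "vt x t * vxx x t = vt x t * (vtt x t - A * (\<bar>vt x t\<bar> powr (p - 2) * vt x t) * vtt x t)"
    by (rule arg_cong)
  also have "\<dots> = vt x t * vtt x t - A * \<bar>vt x t\<bar> powr p * vtt x t"
    by (simp add: abs_powr_split[of "vt x t" p] algebra_simps)
  finally show ?thesis using d p by (simp add: mult.assoc)
qed

lemma continuous_on_energy:
  assumes "continuous_on X f" "continuous_on X g" "\<And>z. z \<in> X \<Longrightarrow> g z \<in> {0..T}"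
  shows "continuous_on X (\<lambda>z. energy (f z) (g z))"
proof -
  have 1: "continuous_on UNIV (\<lambda>s::real. \<bar>s\<bar> powr p * s)"
    by (rule DERIV_continuous_on) (rule has_real_derivative_abs_powr_mult[OF p])
  have "continuous_on X (\<lambda>z. \<bar>vt (f z) (g z)\<bar> powr p * vt (f z) (g z))"
    by (rule continuous_on_compose2[OF 1 cont_strip(2)[OF assms]]) auto
  note 2 = continuous_on_mult_left[OF this]
  have 3: "continuous_on X (\<lambda>z. (vt (f z) (g z))\<^sup>2 / 2)" "continuous_on X (\<lambda>z. (vx (f z) (g z))\<^sup>2 / 2)"
    by (auto intro!: continuous_intros cont_strip assms)
  show ?thesis
    unfolding energy_def by (rule continuous_on_add[OF continuous_on_diff[OF 3(1) 2] 3(2)])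
qed

text \<open>For small \<open>vt\<close> the term of degree \<open>p + 1\<close> in
  \<open>energy\<close> is a small fraction of \<open>vt^2\<close>. The share
  \<open>(1 - 1 / c^2) / 2\<close> that may be lost determines \<open>m\<close>, and
  \<open>\<delta>\<close> solves \<open>\<delta> powr (p - 1) = m\<close>.\<close>

lemma energy_lower_bound:
  assumes c: "c > 1"
  obtains \<delta> where "\<delta> > 0"
    "\<And>x t. \<bar>vt x t\<bar> \<le> \<delta> \<Longrightarrow> ((vt x t / c)\<^sup>2 + (vx x t)\<^sup>2) / 2 \<le> energy x t"
proof
  define m where "m = (1 - 1 / c\<^sup>2) * (p + 1) / (2 * A)"
  have "1 / c\<^sup>2 < 1" using c by simp
  then have m: "m > 0" using A p by (simp add: m_def)
  define \<delta> where "\<delta> = m powr (1 / (p - 1))"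
  show "\<delta> > 0" using m by (simp add: \<delta>_def)
  fix x t assume "\<bar>vt x t\<bar> \<le> \<delta>"
  define q where "q = vt x t"
  have "\<bar>q\<bar> powr (p - 1) \<le> \<delta> powr (p - 1)"
    using \<open>\<bar>vt x t\<bar> \<le> \<delta>\<close> p by (intro powr_mono2) (auto simp: q_def)
  also have "\<dots> = m" using m p by (simp add: \<delta>_def powr_powr)
  finally have qm: "\<bar>q\<bar> powr (p - 1) \<le> m" .
  have "\<bar>q\<bar> powr p * q \<le> \<bar>q\<bar> powr p * \<bar>q\<bar>"
    by (intro mult_left_mono) auto
  also have "\<bar>q\<bar> powr p * \<bar>q\<bar> = \<bar>q\<bar> powr (p - 1) * q\<^sup>2"
    using powr_add[of "\<bar>q\<bar>" "p - 1" 1] by (cases "q = 0") (auto simp: power2_eq_square)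
  also have "\<dots> \<le> m * q\<^sup>2" using qm by (intro mult_right_mono) auto
  finally have "A / (p + 1) * (\<bar>q\<bar> powr p * q) \<le> A / (p + 1) * (m * q\<^sup>2)"
    using A p by (intro mult_left_mono) auto
  also have "\<dots> = (1 - 1 / c\<^sup>2) * q\<^sup>2 / 2"
    using A p by (simp add: m_def)
  also have "\<dots> = q\<^sup>2 / 2 - (q / c)\<^sup>2 / 2" by (simp add: field_simps)
  finally show "((vt x t / c)\<^sup>2 + (vx x t)\<^sup>2) / 2 \<le> energy x t"
    unfolding energy_def q_def by (simp only: add_divide_distrib)
qed

text \<open>While \<open>vt\<close> is small, \<open>\<bar>vt vx\<bar> \<le> c * energy\<close>, so
  on a cone of slope \<open>c\<close> the shrinking cutoff outweighs the flux and the weighted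
  energy cannot grow. It is zero at \<open>\<tau>\<close> and nonnegative at \<open>s\<close>, hence
  zero there.\<close>

lemma cone_energy_step:
  assumes c: "c > 1" and t0: "t0 \<in> {0..T}" and \<tau>: "0 \<le> \<tau>" "\<tau> \<le> s" "s \<le> t0"
    and lb: "\<And>x t. \<bar>vt x t\<bar> \<le> \<delta> \<Longrightarrow> ((vt x t / c)\<^sup>2 + (vx x t)\<^sup>2) / 2 \<le> energy x t"
    and small: "\<And>x t. t \<in> {\<tau>..s} \<Longrightarrow> \<bar>x - x0\<bar> < c * (t0 - t) \<Longrightarrow> \<bar>vt x t\<bar> \<le> \<delta>"
    and init: "\<And>x. \<bar>x - x0\<bar> < c * (t0 - \<tau>) \<Longrightarrow> vt x \<tau> = 0 \<and> vx x \<tau> = 0"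
    and x: "\<bar>x - x0\<bar> < c * (t0 - s)"
  shows "vt x s = 0 \<and> vx x s = 0"
proof -
  define R where "R = c * t0"
  \<comment> \<open>\<open>m\<^sup>2\<close> is a \<open>C\<^sup>1\<close> cutoff to the cone, which keeps the domain of integration fixed.\<close>
  define m where "m x t = max 0 (c\<^sup>2 * (t0 - t)\<^sup>2 - (x - x0)\<^sup>2)" for x t
  define w where "w x t = (m x t)\<^sup>2 * energy x t" for x t
  define wt where "wt x t = 2 * m x t * (- 2 * c\<^sup>2 * (t0 - t)) * energy x t
      + (m x t)\<^sup>2 * (vt x t * vxx x t + vx x t * vxt x t)" for x t
  have sub: "{\<tau>..s} \<subseteq> {0..T}" using \<tau> t0 by auto
  have m_cone: "0 < m x t \<longleftrightarrow> \<bar>x - x0\<bar> < c * (t0 - t)" if "t \<le> t0" for x t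
  proof -
    have "0 < m x t \<longleftrightarrow> \<bar>x - x0\<bar>\<^sup>2 < (c * (t0 - t))\<^sup>2"
      by (auto simp: m_def max_def power_mult_distrib)
    also have "\<dots> \<longleftrightarrow> \<bar>x - x0\<bar> < c * (t0 - t)"
      using that c unfolding not_le[symmetric] by (subst power_mono_iff) auto
    finally show ?thesis .
  qed
  have m_nonneg: "0 \<le> m x t" for x t by (simp add: m_def)
  have m_outside: "m x t = 0" if "t \<le> t0" "\<not> \<bar>x - x0\<bar> < c * (t0 - t)" for x t
    using m_cone[OF that(1), of x] m_nonneg[of x t] that(2) by auto
  have cont_m: "continuous_on X (\<lambda>z. m (f z) (g z))"
    if "continuous_on X f" "continuous_on X g" for X :: "'z::topological_space set" and f g
    unfolding m_def by (intro continuous_intros that)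
  have cont_w: "continuous_on {x0-R..x0+R} (\<lambda>x. w x t)" if "t \<in> {0..T}" for t
    unfolding w_def by (intro continuous_intros cont_m continuous_on_energy) (use that in auto)
  define E where "E t = integral {x0-R..x0+R} (\<lambda>x. w x t)" for t
  have E_t: "(E has_real_derivative integral {x0-R..x0+R} (\<lambda>x. wt x t)) (at t within {0..T})"
    if t: "t \<in> {0..T}" for t
    unfolding E_def
  proof (rule has_real_derivative_slice_integral)
    show "(w x has_real_derivative wt x t) (at t within {0..T})" if "t \<in> {0..T}" for x t
      unfolding w_def wt_def m_def
      by (rule derivative_eq_intros energy_t that DERIV_chain2[OF has_real_derivative_max_0_power2] refl | simp add: algebra_simps)+
    show "continuous_on ({x0-R..x0+R} \<times> {0..T}) (\<lambda>(x, t). wt x t)"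
      unfolding wt_def split_beta
      by (intro continuous_intros cont_m cont_strip continuous_on_energy) auto
  qed (use t cont_w in auto)
  \<comment> \<open>The interval of integration is the base of the cone, so the cutoff vanishes at
    both ends and the flux integrates to 0.\<close>
  have flux: "((\<lambda>x. 2 * m x t * (- 2 * (x - x0)) * (vt x t * vx x t)
      + (m x t)\<^sup>2 * (vxt x t * vx x t + vt x t * vxx x t)) has_integral 0) {x0-R..x0+R}"
    if t: "t \<in> {0..t0}" for t
  proof -
    have R: "0 \<le> R" using c t0 by (simp add: R_def)
    have tT: "t \<in> {0..T}" using t t0 by auto
    have "c * (t0 - t) \<le> R" using t c by (simp add: R_def)
    then have 0: "m (x0 - R) t = 0" "m (x0 + R) t = 0"
      using t R by (auto intro!: m_outside)
    have "((\<lambda>x. 2 * m x t * (- 2 * (x - x0)) * (vt x t * vx x t)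
      + (m x t)\<^sup>2 * (vxt x t * vx x t + vt x t * vxx x t)) has_integral
       (m (x0 + R) t)\<^sup>2 * (vt (x0 + R) t * vx (x0 + R) t) - (m (x0 - R) t)\<^sup>2 * (vt (x0 - R) t * vx (x0 - R) t))
       {x0-R..x0+R}"
    proof (rule fundamental_theorem_of_calculus)
      fix x
      have "((\<lambda>x. (m x t)\<^sup>2 * (vt x t * vx x t)) has_real_derivative 2 * m x t * (- 2 * (x - x0)) * (vt x t * vx x t)
          + (m x t)\<^sup>2 * (vxt x t * vx x t + vt x t * vxx x t)) (at x)"
        unfolding m_def
        by (rule derivative_eq_intros vt_x vx_x tT DERIV_chain2[OF has_real_derivative_max_0_power2] refl | simp add: algebra_simps)+
      then show "((\<lambda>x. (m x t)\<^sup>2 * (vt x t * vx x t)) has_vector_derivative 2 * m x t * (- 2 * (x - x0)) * (vt x t * vx x t)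
          + (m x t)\<^sup>2 * (vxt x t * vx x t + vt x t * vxx x t)) (at x within {x0-R..x0+R})"
        by (simp add: has_real_derivative_iff_has_vector_derivative has_vector_derivative_at_within)
    qed (use R in simp)
    then show ?thesis by (simp add: 0)
  qed
  have E'_le: "integral {x0-R..x0+R} (\<lambda>x. wt x t) \<le> 0" if t: "t \<in> {\<tau>..s}" for t
  proof -
    have tT: "t \<in> {0..T}" "t \<in> {0..t0}" "t \<le> t0" using t sub \<tau> by auto
    define G where "G x = 2 * m x t * (- 2 * (x - x0)) * (vt x t * vx x t)
      + (m x t)\<^sup>2 * (vxt x t * vx x t + vt x t * vxx x t)" for x
    have G: "(G has_integral 0) {x0-R..x0+R}"
      using flux[OF tT(2)] unfolding G_def .
    \<comment> \<open>The terms with second derivatives agree, so inside the cone it suffices that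
      \<open>(x - x0) * (vt * vx) \<le> c^2 * (t0 - t) * energy\<close>; outside it both sides
      vanish.\<close>
    have "wt x t \<le> G x" for x
    proof (cases "\<bar>x - x0\<bar> < c * (t0 - t)")
      case False
      then show ?thesis using m_outside[OF tT(3) False] by (simp add: wt_def G_def)
    next
      case True
      define r where "r = vx x t"
      define q where "q = vt x t"
      have "0 \<le> (\<bar>q\<bar> / c - \<bar>r\<bar>)\<^sup>2" by simp
      also have "\<dots> = (q / c)\<^sup>2 + r\<^sup>2 - 2 * (\<bar>q\<bar> / c * \<bar>r\<bar>)"
        by (simp add: power2_eq_square algebra_simps)
      finally have "\<bar>q\<bar> * \<bar>r\<bar> / c \<le> energy x t"
        using lb[OF small[OF t True]] by (simp add: q_def r_def)
      then have qr: "\<bar>q * r\<bar> \<le> c * energy x t" using c by (simp add: field_simps abs_mult)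
      have "(x - x0) * (q * r) \<le> \<bar>x - x0\<bar> * \<bar>q * r\<bar>"
        by (metis abs_ge_self abs_mult)
      also have "\<dots> \<le> (c * (t0 - t)) * (c * energy x t)"
        using True qr by (intro mult_mono) auto
      finally have "2 * m x t * 2 * ((x - x0) * (q * r)) \<le> 2 * m x t * 2 * ((c * (t0 - t)) * (c * energy x t))"
        using m_nonneg by (intro mult_left_mono) auto
      then show ?thesis
        by (simp add: wt_def G_def q_def r_def power2_eq_square algebra_simps)
    qed
    moreover have "(\<lambda>x. wt x t) integrable_on {x0-R..x0+R}"
      unfolding wt_def
      by (intro integrable_continuous_real continuous_intros cont_m cont_strip continuous_on_energy)
        (use tT in auto)
    ultimately have "integral {x0-R..x0+R} (\<lambda>x. wt x t) \<le> integral {x0-R..x0+R} G"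
      using G by (intro integral_le) auto
    then show ?thesis using G by (simp add: integral_unique)
  qed
  have "- E \<tau> \<le> - E s"
  proof (rule nonneg_derivative_imp_le[where \<phi> = "\<lambda>t. - E t" and S = "{0..T}" and a = \<tau> and b = s
        and \<phi>' = "\<lambda>t. - integral {x0-R..x0+R} (\<lambda>x. wt x t)"])
    show "((\<lambda>t. - E t) has_real_derivative - integral {x0-R..x0+R} (\<lambda>x. wt x t)) (at t within {0..T})"
      if "t \<in> {\<tau>..s}" for t
      using E_t[of t] that sub by (auto intro!: derivative_eq_intros)
  qed (use \<tau> sub E'_le in auto)
  moreover have "E \<tau> = 0"
  proof -
    have "w x \<tau> = 0" for x
      using m_outside[of \<tau> x] init[of x] \<tau> by (cases "\<bar>x - x0\<bar> < c * (t0 - \<tau>)") (auto simp: w_def energy_def)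
    then show ?thesis by (simp add: E_def)
  qed
  moreover have w_nonneg: "0 \<le> w x s" for x
  proof (cases "\<bar>x - x0\<bar> < c * (t0 - s)")
    case True
    have "0 \<le> ((vt x s / c)\<^sup>2 + (vx x s)\<^sup>2) / 2" by simp
    also have "\<dots> \<le> energy x s" using True \<tau> by (intro lb small) auto
    finally show ?thesis by (simp add: w_def)
  qed (use m_outside[of s] \<tau> in \<open>auto simp: w_def\<close>)
  moreover have "0 \<le> E s" unfolding E_def
    using cont_w[of s] \<tau> t0 w_nonneg by (intro integral_nonneg integrable_continuous_real) auto
  ultimately have "E s = 0" by simp
  have "c * (t0 - s) \<le> R" using \<tau> c by (simp add: R_def)
  then have xR: "x \<in> {x0-R..x0+R}" "0 < R" using x by auto
  have "w x s = 0"
    using \<open>E s = 0\<close> integral_eq_0_iff[of "x0-R" "x0+R" "\<lambda>x. w x s"] cont_w[of s] \<tau> t0 w_nonneg xR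
    unfolding E_def by auto
  moreover have "m x s \<noteq> 0" using m_cone[of s x] x \<tau> by auto
  ultimately have "energy x s = 0" by (simp add: w_def)
  then have "(vt x s / c)\<^sup>2 + (vx x s)\<^sup>2 \<le> 0"
    using lb[OF small[of s x]] x \<tau> by auto
  then show ?thesis using c by (simp add: sum_power2_le_zero_iff)
qed

text \<open>\<open>cone_energy_step\<close> is applied on successive time slabs of height
  \<open>\<eta>\<close>, starting from the data. On the axis \<open>x = x0\<close> this leaves
  \<open>vt = 0\<close> at all times before \<open>t0\<close>, hence \<open>v\<close> keeps its
  initial value there.\<close>

lemma cone_vanish:
  assumes c: "c > 1" and t0: "0 < t0" "t0 \<le> T"
    and data: "\<And>x. \<bar>x - x0\<bar> < c * t0 \<Longrightarrow> v x 0 = 0 \<and> vt x 0 = 0"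
  shows "v x0 t0 = 0"
proof -
  obtain \<delta> where \<delta>: "\<delta> > 0"
    and lb: "\<And>x t. \<bar>vt x t\<bar> \<le> \<delta> \<Longrightarrow> ((vt x t / c)\<^sup>2 + (vx x t)\<^sup>2) / 2 \<le> energy x t"
    using energy_lower_bound[OF c] by metis
  define R where "R = c * t0"
  define K where "K = {x0-R..x0+R} \<times> {0..t0}"
  have "uniformly_continuous_on K (\<lambda>(x, t). vt x t)"
  proof (rule compact_uniformly_continuous)
    show "continuous_on K (\<lambda>(x, t). vt x t)"
      by (rule continuous_on_subset[OF cont_vt]) (use t0 in \<open>auto simp: K_def\<close>)
  qed (simp add: K_def compact_Times)
  then obtain d where d: "d > 0"
    and dK: "\<And>z z'. z \<in> K \<Longrightarrow> z' \<in> K \<Longrightarrow> dist z' z < d \<Longrightarrow>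
      dist (case z' of (x, t) \<Rightarrow> vt x t) (case z of (x, t) \<Rightarrow> vt x t) < \<delta>"
    using \<delta> unfolding uniformly_continuous_on_def by metis
  \<comment> \<open>Smallness of \<open>v\<^sub>t\<close> is not known a priori; uniform continuity propagates it over time steps \<open>\<eta>\<close>.\<close>
  define \<eta> where "\<eta> = d / 2"
  have \<eta>: "\<eta> > 0" using d by (simp add: \<eta>_def)
  have zero: "vt x s = 0 \<and> vx x s = 0"
    if "s \<in> {0..t0}" "s \<le> real n * \<eta>" "\<bar>x - x0\<bar> < c * (t0 - s)" for n s x
    using that
  proof (induction n arbitrary: s x)
    case 0
    then have s: "s = 0" by simp
    have "((\<lambda>y. 0) has_real_derivative vx x 0) (at x)"
    proof (rule has_field_derivative_transform_within_open[where f = "\<lambda>y. v y 0"])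
      show "((\<lambda>y. v y 0) has_real_derivative vx x 0) (at x)" using v_x[of 0 x] T by simp
      show "open {x0 - c * t0<..<x0 + c * t0}" by simp
      show "x \<in> {x0 - c * t0<..<x0 + c * t0}" using 0 s by (auto simp: abs_less_iff)
      show "v y 0 = 0" if "y \<in> {x0 - c * t0<..<x0 + c * t0}" for y
        using data[of y] that by (auto simp: abs_less_iff)
    qed
    then have "vx x 0 = 0" using DERIV_unique DERIV_const by blast
    then show ?case using data[of x] 0 s by simp
  next
    case (Suc n)
    define \<tau> where "\<tau> = real n * \<eta>"
    show ?case
    proof (cases "s \<le> \<tau>")
      case True
      then show ?thesis using Suc by (simp add: \<tau>_def)
    next
      case False
      have \<tau>: "0 \<le> \<tau>" "\<tau> \<le> s" "s \<le> t0" "s \<le> \<tau> + \<eta>"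
        using False \<eta> Suc.prems by (auto simp: \<tau>_def algebra_simps)
      have init: "vt y \<tau> = 0 \<and> vx y \<tau> = 0" if "\<bar>y - x0\<bar> < c * (t0 - \<tau>)" for y
        by (rule Suc.IH) (use \<tau> that in \<open>auto simp: \<tau>_def\<close>)
      show ?thesis
      proof (rule cone_energy_step[OF c _ \<tau>(1-3) lb _ init Suc.prems(3)])
        fix y t assume t: "t \<in> {\<tau>..s}" and y: "\<bar>y - x0\<bar> < c * (t0 - t)"
        have "c * (t0 - t) \<le> c * (t0 - \<tau>)" using t c by simp
        then have y\<tau>: "\<bar>y - x0\<bar> < c * (t0 - \<tau>)" using y by linarith
        have "c * (t0 - \<tau>) \<le> R" using \<tau> c by (simp add: R_def)
        then have "(y, t) \<in> K" "(y, \<tau>) \<in> K" using y\<tau> t \<tau> by (auto simp: K_def)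
        moreover have "dist (y, t) (y, \<tau>) < d"
          using t \<tau> d by (auto simp: dist_Pair_Pair dist_real_def \<eta>_def)
        ultimately have "dist (vt y t) (vt y \<tau>) < \<delta>"
          using dK[of "(y, \<tau>)" "(y, t)"] by simp
        then show "\<bar>vt y t\<bar> \<le> \<delta>" using init[OF y\<tau>] by (simp add: dist_real_def)
      qed (use t0 in auto)
    qed
  qed
  have "v x0 t0 = v x0 0"
  proof (rule DERIV_isconst_end[OF t0(1)])
    show "continuous_on {0..t0} (v x0)"
      by (rule cont_strip) (use t0 in \<open>auto intro: continuous_intros\<close>)
    fix s assume s: "0 < s" "s < t0"
    obtain n where "s / \<eta> \<le> real n" using real_arch_simple by blast
    then have "vt x0 s = 0" using zero[of s n x0] s c \<eta> by (simp add: field_simps)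
    then show "DERIV (v x0) s :> 0"
      using v_t[of s x0] s t0 at_within_Icc_at[of 0 s T] by auto
  qed
  then show ?thesis using data[of x0] c t0 by simp
qed

text \<open>For \<open>t > 0\<close> such a point is the apex of a cone of slope above 1 whose base
  still misses the support of the data. The statements on \<open>vt\<close> and \<open>vx\<close>
  follow by differentiating the zero function.\<close>

lemma finite_speed:
  assumes data: "\<And>x. \<sigma> < \<bar>x\<bar> \<Longrightarrow> v x 0 = 0 \<and> vt x 0 = 0"
    and t: "t \<in> {0..T}" and x: "\<sigma> + t < \<bar>x\<bar>"
  shows "v x t = 0" "vt x t = 0" "vx x t = 0"
proof -
  have v0: "v y s = 0" if s: "s \<in> {0..T}" and y: "\<sigma> + s < \<bar>y\<bar>" for y s
  proof (cases "s = 0")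
    case True
    then show ?thesis using data y by simp
  next
    case False
    then have s0: "0 < s" using s by simp
    \<comment> \<open>The base radius \<open>c * s\<close> exceeds \<open>s\<close> by half of the
      gap \<open>\<bar>y\<bar> - \<sigma> - s\<close>.\<close>
    define c where "c = 1 + (\<bar>y\<bar> - \<sigma> - s) / (2 * s)"
    have cs: "c * s = s + (\<bar>y\<bar> - \<sigma> - s) / 2" using s0 by (simp add: c_def field_simps)
    show ?thesis
    proof (rule cone_vanish)
      show "1 < c" using s0 y by (simp add: c_def)
      show "v z 0 = 0 \<and> vt z 0 = 0" if "\<bar>z - y\<bar> < c * s" for z
      proof (rule data)
        have "\<sigma> < b" if "a \<le> b + d" "\<sigma> + s < a" "d < s + (a - \<sigma> - s) / 2" for a b d
          using that by (simp add: field_simps)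
        moreover have "\<bar>y\<bar> \<le> \<bar>z\<bar> + \<bar>z - y\<bar>" by linarith
        ultimately show "\<sigma> < \<bar>z\<bar>" using that y cs by metis
      qed
    qed (use s s0 in auto)
  qed
  show "v x t = 0" by (rule v0[OF t x])
  show "vt x t = 0"
  proof (cases "t = 0")
    case True
    then show ?thesis using data x by simp
  next
    case False
    \<comment> \<open>At this \<open>x\<close> the support bound is sure to persist only backwards
      in time, hence the derivative from the left.\<close>
    have "(v x has_real_derivative vt x t) (at t within {0..t})"
      using v_t[OF t] by (rule has_field_derivative_subset) (use t in auto)
    then have "((\<lambda>s. 0) has_real_derivative vt x t) (at t within {0..t})"
      by (rule has_field_derivative_transform_within[OF _ zero_less_one]) (use t x in \<open>auto intro!: v0\<close>)
    moreover have "((\<lambda>s. 0) has_real_derivative 0) (at t within {0..t})" by simp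
    ultimately show ?thesis
      by (rule has_real_derivative_unique_Icc[rotated 2]) (use t False in auto)
  qed
  have "((\<lambda>y. 0) has_real_derivative vx x t) (at x)"
  proof (rule has_field_derivative_transform_within_open[where f = "\<lambda>y. v y t"])
    show "open {y. \<sigma> + t < \<bar>y\<bar>}" by (intro open_Collect_less continuous_intros)
  qed (use v_x[OF t] x v0[OF t] in auto)
  then show "vx x t = 0" using DERIV_unique DERIV_const by blast
qed

section \<open>Weighted averages and the bound on the life span\<close>

text \<open>The weight \<open>exp (x - t)\<close> solves the adjoint linear wave equation, so for
  \<open>F(t) = \<integral> exp (x - t) v\<close> and \<open>N(t) = \<integral> exp (x - t) h\<close>, where \<open>h = A \<bar>v\<^sub>t\<bar>\<^bsup>p\<^esup> / p\<close>, the sum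
  \<open>Z = \<integral> exp (x - t) (v\<^sub>t + v - h) = F' + 2 F - N\<close> satisfies \<open>Z' = N\<close>.\<close>

lemma life_span_bound:
  assumes \<sigma>: "0 < \<sigma>"
    and data: "\<And>x. \<sigma> < \<bar>x\<bar> \<Longrightarrow> v x 0 = 0 \<and> vt x 0 = 0"
    and v_nonneg: "\<And>x. 0 \<le> v x 0" and vt_nonneg: "\<And>x. 0 \<le> vt x 0"
    and small: "\<And>x. A / p * \<bar>vt x 0\<bar> powr p \<le> vt x 0 / 2"
    and m: "0 < m" "m \<le> integral {-\<sigma>..\<sigma>} (\<lambda>x. exp x * (v x 0 + vt x 0)) / 2"
  shows "T \<le> 4 + (m / 4) powr (1 - p) * (4 * (p / A) * (4 * exp \<sigma>) powr (p - 1)) / (p - 1)"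
proof -
  \<comment> \<open>The extra 1 keeps \<open>- R\<close> and \<open>R\<close> strictly outside the
    support for all times up to \<open>T\<close>, so that boundary terms vanish.\<close>
  define R where "R = \<sigma> + T + 1"
  define h where "h x t = A / p * \<bar>vt x t\<bar> powr p" for x t
  define F where "F t = integral {-R..R} (\<lambda>x. exp (x - t) * v x t)" for t
  define X where "X t = integral {-R..R} (\<lambda>x. exp (x - t) * vt x t)" for t
  define N where "N t = integral {-R..R} (\<lambda>x. exp (x - t) * h x t)" for t
  define Z where "Z t = integral {-R..R} (\<lambda>x. exp (x - t) * (vt x t + v x t - h x t))" for t
  have cont_h: "continuous_on S (\<lambda>z. h (f z) (g z))"
    if "continuous_on S f" "continuous_on S g" "\<And>z. z \<in> S \<Longrightarrow> g z \<in> {0..T}"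
    for S :: "'z::topological_space set" and f g
    unfolding h_def using p
    by (intro continuous_on_mult_left continuous_on_compose2[OF DERIV_continuous_on[OF has_real_derivative_abs_powr] cont_strip(2)[OF that]]) auto
  have fin: "v x t = 0" "vt x t = 0" "vx x t = 0" if "t \<in> {0..T}" "\<sigma> + t < \<bar>x\<bar>" for x t
    by (rule finite_speed[of \<sigma>]; use data that in blast)+
  have slice: "(\<lambda>x. exp (x - t) * v x t) integrable_on {a..b}"
    "(\<lambda>x. exp (x - t) * vt x t) integrable_on {a..b}"
    "(\<lambda>x. exp (x - t) * h x t) integrable_on {a..b}" if "t \<in> {0..T}" for t a b
    by (intro integrable_continuous_real continuous_intros cont_strip cont_h; use that in auto)+
  have Z_eq: "Z t = X t + F t - N t" if "t \<in> {0..T}" for t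
  proof -
    have "Z t = integral {-R..R} (\<lambda>x. exp (x - t) * vt x t + exp (x - t) * v x t - exp (x - t) * h x t)"
      by (simp add: Z_def algebra_simps)
    also have "\<dots> = X t + F t - N t"
      using slice[OF that, of "-R" R] unfolding X_def F_def N_def
      by (simp add: integral_diff integral_add integrable_add)
    finally show ?thesis .
  qed
  have F_t: "(F has_real_derivative X t - F t) (at t within {0..T})" if t: "t \<in> {0..T}" for t
  proof -
    have "(F has_real_derivative integral {-R..R} (\<lambda>x. exp (x - t) * vt x t - exp (x - t) * v x t)) (at t within {0..T})"
      unfolding F_def
    proof (rule has_real_derivative_slice_integral)
      show "((\<lambda>s. exp (x - s) * v x s) has_real_derivative exp (x - t) * vt x t - exp (x - t) * v x t) (at t within {0..T})"
        if "t \<in> {0..T}" for x t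
        by (rule derivative_eq_intros v_t that refl | simp add: algebra_simps)+
      show "continuous_on {-R..R} (\<lambda>x. exp (x - t) * v x t)" if "t \<in> {0..T}" for t
        by (intro continuous_intros cont_strip) (use that in auto)
      show "continuous_on ({-R..R} \<times> {0..T}) (\<lambda>(x, t). exp (x - t) * vt x t - exp (x - t) * v x t)"
        unfolding split_beta by (intro continuous_intros cont_strip) auto
    qed (use t in auto)
    then show ?thesis
      using slice[OF t, of "-R" R] by (simp add: X_def F_def integral_diff)
  qed
  have Z_t: "(Z has_real_derivative N t) (at t within {0..T})" if t: "t \<in> {0..T}" for t
  proof -
    have d: "(Z has_real_derivative integral {-R..R} (\<lambda>x. exp (x - t) * (vxx x t - v x t + h x t))) (at t within {0..T})"
      unfolding Z_def
    proof (rule has_real_derivative_slice_integral)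
      fix x t assume t: "t \<in> {0..T}"
      have "((\<lambda>s. vt x s + v x s - h x s) has_real_derivative
          vtt x t + vt x t - A / p * (p * (\<bar>vt x t\<bar> powr (p - 2) * vt x t) * vtt x t)) (at t within {0..T})"
        unfolding h_def
        by (rule derivative_eq_intros v_t vt_t t DERIV_chain2[OF has_real_derivative_abs_powr[OF p]] refl | simp)+
      moreover have "vtt x t + vt x t - A / p * (p * (\<bar>vt x t\<bar> powr (p - 2) * vt x t) * vtt x t) = vxx x t + vt x t"
        using wave_eq[OF t, of x] p by (simp add: mult.assoc)
      ultimately have "((\<lambda>s. vt x s + v x s - h x s) has_real_derivative vxx x t + vt x t) (at t within {0..T})"
        by (simp only:)
      note DERIV_mult[OF _ this]
      moreover have "((\<lambda>s. exp (x - s)) has_real_derivative - exp (x - t)) (at t within {0..T})"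
        by (auto intro!: derivative_eq_intros)
      ultimately have "((\<lambda>s. exp (x - s) * (vt x s + v x s - h x s)) has_real_derivative
          - exp (x - t) * (vt x t + v x t - h x t) + (vxx x t + vt x t) * exp (x - t)) (at t within {0..T})"
        by blast
      then show "((\<lambda>s. exp (x - s) * (vt x s + v x s - h x s)) has_real_derivative
          exp (x - t) * (vxx x t - v x t + h x t)) (at t within {0..T})"
        by (rule DERIV_cong) (simp add: algebra_simps)
    next
      show "continuous_on {-R..R} (\<lambda>x. exp (x - t) * (vt x t + v x t - h x t))" if "t \<in> {0..T}" for t
        by (intro continuous_intros cont_strip cont_h) (use that in auto)
      show "continuous_on ({-R..R} \<times> {0..T}) (\<lambda>(x, t). exp (x - t) * (vxx x t - v x t + h x t))"
        unfolding split_beta by (intro continuous_intros cont_strip cont_h) auto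
    qed (use t in auto)
    \<comment> \<open>Two integrations by parts at once: the integrand is the exact
      \<open>x\<close>-derivative of \<open>exp (x - t) * (vx - v)\<close>, so only
      \<open>N t\<close> will remain.\<close>
    have "((\<lambda>x. exp (x - t) * (vxx x t - v x t)) has_integral
        exp (R - t) * (vx R t - v R t) - exp (- R - t) * (vx (- R) t - v (- R) t)) {-R..R}"
    proof (rule fundamental_theorem_of_calculus)
      fix x
      have "((\<lambda>x. exp (x - t) * (vx x t - v x t)) has_real_derivative exp (x - t) * (vxx x t - v x t)) (at x)"
        by (rule derivative_eq_intros v_x vx_x t refl | simp add: algebra_simps)+
      then show "((\<lambda>x. exp (x - t) * (vx x t - v x t)) has_vector_derivative exp (x - t) * (vxx x t - v x t)) (at x within {-R..R})"
        by (simp add: has_real_derivative_iff_has_vector_derivative has_vector_derivative_at_within)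
    qed (use \<sigma> T in \<open>simp add: R_def\<close>)
    moreover have "\<sigma> + t < \<bar>R\<bar>" "\<sigma> + t < \<bar>- R\<bar>" using t \<sigma> by (auto simp: R_def)
    ultimately have "((\<lambda>x. exp (x - t) * (vxx x t - v x t)) has_integral 0) {-R..R}"
      by (simp add: fin[OF t])
    then have "((\<lambda>x. exp (x - t) * (vxx x t - v x t) + exp (x - t) * h x t) has_integral 0 + N t) {-R..R}"
      unfolding N_def using slice(3)[OF t] by (intro has_integral_add integrable_integral)
    then have "integral {-R..R} (\<lambda>x. exp (x - t) * (vxx x t - v x t + h x t)) = N t"
      by (simp add: integral_unique distrib_left)
    with d show ?thesis by simp
  qed
  have h_nonneg: "0 \<le> h x t" for x t using A p by (simp add: h_def)
  have bound: "X t \<le> \<theta> * exp \<sigma> + \<theta> powr (1 - p) * (p / A) * N t"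
    if t: "t \<in> {0..T}" and \<theta>: "\<theta> > 0" for t \<theta>
  proof -
    \<comment> \<open>Cutting at the front \<open>b\<close> of the support makes the bound uniform
      in \<open>t\<close>: over \<open>{-R..b}\<close> the weight has integral at most
      \<open>exp (b - t) = exp \<sigma>\<close>.\<close>
    define b where "b = \<sigma> + t"
    define \<kappa> where "\<kappa> = \<theta> powr (1 - p) * (p / A)"
    have b: "- R \<le> b" "b \<le> R" using \<sigma> T t by (auto simp: b_def R_def)
    have outside: "vt x t = 0" if "b < x" for x
      using fin(2)[OF t, of x] that \<sigma> t by (auto simp: b_def)
    have exp_int: "(\<lambda>x. exp (x - t)) integrable_on {-R..b}"
      by (intro integrable_continuous_real continuous_intros)
    have "integral {b..R} (\<lambda>x. exp (x - t) * vt x t) = integral {b..R} (\<lambda>x. 0)"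
      by (rule integral_spike[of "{b}"]) (use outside in auto)
    then have "X t = integral {-R..b} (\<lambda>x. exp (x - t) * vt x t)"
      unfolding X_def using Henstock_Kurzweil_Integration.integral_combine[OF b slice(2)[OF t]] by simp
    also have "\<dots> \<le> integral {-R..b} (\<lambda>x. \<theta> * exp (x - t) + \<kappa> * (exp (x - t) * h x t))"
    proof (rule integral_le)
      show "(\<lambda>x. \<theta> * exp (x - t) + \<kappa> * (exp (x - t) * h x t)) integrable_on {-R..b}"
        by (intro integrable_continuous_real continuous_intros cont_h) (use t in auto)
      fix x
      have "exp (x - t) * vt x t \<le> exp (x - t) * (\<theta> + \<theta> powr (1 - p) * \<bar>vt x t\<bar> powr p)"
        using le_add_powr_mult[OF p \<theta>] by (intro mult_left_mono) auto
      also have "\<dots> = \<theta> * exp (x - t) + \<kappa> * (exp (x - t) * h x t)"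
        using A p by (simp add: \<kappa>_def h_def algebra_simps)
      finally show "exp (x - t) * vt x t \<le> \<theta> * exp (x - t) + \<kappa> * (exp (x - t) * h x t)" .
    qed (rule slice(2)[OF t])
    also have "\<dots> = \<theta> * integral {-R..b} (\<lambda>x. exp (x - t)) + \<kappa> * integral {-R..b} (\<lambda>x. exp (x - t) * h x t)"
      using integral_add[OF integrable_on_mult_right[OF exp_int, of \<theta>]
          integrable_on_mult_right[OF slice(3)[OF t], of \<kappa>]] by simp
    also have "\<dots> \<le> \<theta> * exp \<sigma> + \<kappa> * N t"
    proof (intro add_mono mult_left_mono)
      have "((\<lambda>x. exp (x - t)) has_integral exp (b - t) - exp (- R - t)) {-R..b}"
        by (rule fundamental_theorem_of_calculus[OF b(1)])
          (auto simp: has_real_derivative_iff_has_vector_derivative[symmetric] intro!: derivative_eq_intros)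
      then show "integral {-R..b} (\<lambda>x. exp (x - t)) \<le> exp \<sigma>"
        by (simp add: integral_unique b_def)
      show "integral {-R..b} (\<lambda>x. exp (x - t) * h x t) \<le> N t"
        unfolding N_def using b slice(3)[OF t] h_nonneg by (intro integral_subset_le) auto
    qed (use \<theta> A p in \<open>auto simp: \<kappa>_def\<close>)
    finally show ?thesis by (simp add: \<kappa>_def)
  qed
  have T0: "0 \<in> {0..T}" using T by simp
  have h0: "h x 0 \<le> vt x 0 / 2" for x using small by (simp add: h_def)
  \<comment> \<open>Smallness at time 0 leaves at least half of \<open>vt\<close>, so the integrand
    is at least \<open>exp x * (v + vt) / 2\<close>; widening the interval only adds nonnegative
    contributions.\<close>
  have Z0: "m \<le> Z 0"
  proof -
    have int: "(\<lambda>x. exp x * (vt x 0 + v x 0 - h x 0)) integrable_on {a..b}"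
      "(\<lambda>x. exp x * (v x 0 + vt x 0)) integrable_on {a..b}" for a b
      by (intro integrable_continuous_real continuous_intros cont_strip cont_h; use T in auto)+
    have "m \<le> integral {-\<sigma>..\<sigma>} (\<lambda>x. 1 / 2 * (exp x * (v x 0 + vt x 0)))"
      using m(2) by simp
    also have "\<dots> \<le> integral {-\<sigma>..\<sigma>} (\<lambda>x. exp x * (vt x 0 + v x 0 - h x 0))"
    proof (rule integral_le[OF integrable_on_mult_right[OF int(2)] int(1)])
      fix x
      have "exp x * ((v x 0 + vt x 0) / 2) \<le> exp x * (vt x 0 + v x 0 - h x 0)"
        using h0[of x] v_nonneg[of x] by (intro mult_left_mono) auto
      then show "1 / 2 * (exp x * (v x 0 + vt x 0)) \<le> exp x * (vt x 0 + v x 0 - h x 0)" by simp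
    qed
    also have "\<dots> \<le> integral {-R..R} (\<lambda>x. exp x * (vt x 0 + v x 0 - h x 0))"
    proof (rule integral_subset_le)
      show "\<forall>x\<in>{-R..R}. 0 \<le> exp x * (vt x 0 + v x 0 - h x 0)"
      proof
        fix x show "0 \<le> exp x * (vt x 0 + v x 0 - h x 0)"
          using h0[of x] v_nonneg[of x] vt_nonneg[of x] by (intro mult_nonneg_nonneg) auto
      qed
    qed (use T int in \<open>auto simp: R_def\<close>)
    also have "\<dots> = Z 0" by (simp add: Z_def)
    finally show ?thesis .
  qed
  have F0: "0 \<le> F 0"
    unfolding F_def using slice(1)[OF T0] v_nonneg by (intro integral_nonneg) auto
  have F0_le: "F 0 \<le> 2 * Z 0"
  proof -
    have "h x 0 \<le> vt x 0" for x using h0[of x] vt_nonneg[of x] by linarith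
    then have "N 0 \<le> X 0"
      unfolding N_def X_def by (intro integral_le slice[OF T0] mult_left_mono) auto
    then show ?thesis using Z_eq[OF T0] F0 by simp
  qed
  \<comment> \<open>The constant \<open>Z\<close> of \<open>blow_up_time\<close> is
    \<open>Z 0\<close>, and its \<open>Y\<close> is the increment \<open>Z t - Z 0\<close>; its
    equation for \<open>F\<close> reads \<open>F' = X - F = Z + N - 2 F\<close>.\<close>
  have "T \<le> 4 + (Z 0 / 4) powr (1 - p) * (4 * (p / A) * (4 * exp \<sigma>) powr (p - 1)) / (p - 1)"
  proof (rule blow_up_time[OF p, where F = F and N = N and Y = "\<lambda>t. Z t - Z 0"])
    show "(F has_real_derivative Z 0 + (Z t - Z 0) + N t - 2 * F t) (at t within {0..T})"
      if "t \<in> {0..T}" for t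
      using F_t[OF that] Z_eq[OF that] by (simp add: algebra_simps)
    show "((\<lambda>t. Z t - Z 0) has_real_derivative N t) (at t within {0..T})" if "t \<in> {0..T}" for t
      using Z_t[OF that] by (auto intro!: derivative_eq_intros)
    show "0 \<le> N t" if "t \<in> {0..T}" for t
      unfolding N_def using slice(3)[OF that] h_nonneg by (intro integral_nonneg) auto
    show "Z 0 + (Z t - Z 0) + N t - F t \<le> \<theta> * exp \<sigma> + \<theta> powr (1 - p) * (p / A) * N t"
      if "t \<in> {0..T}" "\<theta> > 0" for t \<theta>
      using bound[OF that] Z_eq[OF that(1)] by simp
  qed (use m Z0 F0 F0_le A p in auto)
  also have "\<dots> \<le> 4 + (m / 4) powr (1 - p) * (4 * (p / A) * (4 * exp \<sigma>) powr (p - 1)) / (p - 1)"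
    using m Z0 p A by (intro add_left_mono divide_right_mono mult_right_mono powr_mono2') auto
  finally show ?thesis .
qed

end

section \<open>From classical solutions to the locale\<close>

lemma Ck_strip_continuous:
  "Ck_strip k T w \<Longrightarrow> continuous_on (UNIV \<times> {0..T}) (\<lambda>(x, t). w x t)"
  by (cases k) auto

lemma Ck_strip_Suc_derivatives:
  assumes "Ck_strip (Suc k) T w" "t \<in> {0..T}"
  shows "((\<lambda>y. w y t) has_real_derivative dx w x t) (at x)"
    and "(w x has_real_derivative dt T w x t) (at t within {0..T})"
proof -
  show "((\<lambda>y. w y t) has_real_derivative dx w x t) (at x)"
    using assms unfolding dx_def by (simp add: DERIV_deriv_iff_real_differentiable)
  show "(w x has_real_derivative dt T w x t) (at t within {0..T})"
    using assms unfolding dt_def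
    by (simp add: has_real_derivative_iff_has_vector_derivative vector_derivative_works[symmetric])
qed

text \<open>The two mixed derivatives agree by \<open>mixed_partials_eq\<close>. The equation is
  given only for \<open>0 < t < T\<close>; both sides are continuous on \<open>{0..T}\<close>, also
  when \<open>p < 2\<close>, so it extends to the end points.\<close>

lemma classical_solution_strip_wave:
  assumes p: "p > 1" and A: "A > 0" and T: "T > 0" and sol: "classical_solution p A \<phi> \<psi> T v"
  shows "strip_wave p A T v (dt T v) (dx v) (dt T (dt T v)) (dx (dx v)) (dx (dt T v))"
proof -
  have C2: "Ck_strip (Suc 1) T v" using sol by (simp add: classical_solution_def numeral_2_eq_2)
  then have C1: "Ck_strip (Suc 0) T (dx v)" "Ck_strip (Suc 0) T (dt T v)" by auto
  then have C0: "Ck_strip 0 T (dx (dx v))" "Ck_strip 0 T (dt T (dx v))"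
    "Ck_strip 0 T (dx (dt T v))" "Ck_strip 0 T (dt T (dt T v))" by auto
  note d = Ck_strip_Suc_derivatives[OF C2] Ck_strip_Suc_derivatives[OF C1(1)]
    Ck_strip_Suc_derivatives[OF C1(2)]
  note c = Ck_strip_continuous[OF C2] Ck_strip_continuous[OF C1(1)] Ck_strip_continuous[OF C1(2)]
    C0[THEN Ck_strip_continuous]
  have mixed: "dx (dt T v) x t = dt T (dx v) x t" if "t \<in> {0..T}" for x t
    by (rule mixed_partials_eq[OF T that d(2) d(1) d(5) d(4)]) (use c in auto)
  have eq: "dt T (dt T v) x t - dx (dx v) x t =
      A * (\<bar>dt T v x t\<bar> powr (p - 2) * dt T v x t) * dt T (dt T v) x t" if t: "t \<in> {0..T}" for x t
  proof -
    have slice: "continuous_on {0..T} (w x)" if "continuous_on (UNIV \<times> {0..T}) (\<lambda>(x, t). w x t)"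
      for w :: "real \<Rightarrow> real \<Rightarrow> real"
      by (rule continuous_on_strip_compose[OF that]) (auto intro: continuous_intros)
    have "continuous_on {0..T} (\<lambda>t. \<bar>dt T v x t\<bar> powr (p - 2) * dt T v x t)"
      by (rule continuous_on_compose2[OF continuous_on_abs_powr_mult[OF p] slice[OF c(3)]]) auto
    note continuous_on_mult[OF continuous_on_mult_left[OF this] slice[OF c(7)]]
    then have "continuous_on (closure {0<..<T}) (\<lambda>t. dt T (dt T v) x t - dx (dx v) x t -
        A * (\<bar>dt T v x t\<bar> powr (p - 2) * dt T v x t) * dt T (dt T v) x t)"
      using T slice[OF c(7)] slice[OF c(4)] by (simp add: continuous_on_diff)
    then have "dt T (dt T v) x t - dx (dx v) x t -
        A * (\<bar>dt T v x t\<bar> powr (p - 2) * dt T v x t) * dt T (dt T v) x t = 0"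
      by (rule continuous_constant_on_closure) (use sol t T in \<open>auto simp: classical_solution_def\<close>)
    then show ?thesis by simp
  qed
  show ?thesis
  proof unfold_locales
    show "(dx v x has_real_derivative dx (dt T v) x t) (at t within {0..T})" if "t \<in> {0..T}" for x t
      using d(4)[OF that] mixed[OF that] by simp
  qed (use p A T c d eq in auto)
qed

section \<open>Choice of the constants and conclusion\<close>

theorem theorem2p2:
  fixes p A \<sigma> :: real and f g :: "real \<Rightarrow> real"
  assumes "p > 1" and "A > 0" and "\<sigma> \<ge> 1"
    and "f \<in> C0k_real 2" and "g \<in> C0k_real 1"
    and "\<forall>x. \<not> \<bar>x\<bar> \<le> \<sigma> \<longrightarrow> f x = 0 \<and> g x = 0"
    and "((\<forall>x. f x \<ge> 0 \<and> g x \<ge> 0) \<and> (\<exists>x. f x \<noteq> 0)) \<or>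
         ((\<forall>x. f x \<ge> 0 \<and> g x \<ge> 0) \<and> (\<exists>x. g x \<noteq> 0))"
  shows "\<exists>\<epsilon>0 > 0. \<exists>C > 0. \<forall>\<epsilon> T. 0 < \<epsilon> \<and> \<epsilon> \<le> \<epsilon>0 \<and> T > C * \<epsilon> powr (- (p - 1)) \<longrightarrow>
           \<not> (\<exists>v. classical_solution p A (\<lambda>x. \<epsilon> * f x) (\<lambda>x. \<epsilon> * g x) T v)"
proof -
  note p = assms(1) and A = assms(2)
  have supp: "f x = 0 \<and> g x = 0" if "\<sigma> < \<bar>x\<bar>" for x using assms(6) that by auto
  have nonneg: "0 \<le> f x" "0 \<le> g x" for x using assms(7) by auto
  have "\<forall>x. f differentiable (at x)" "\<forall>x. g differentiable (at x)"
    using assms(4,5) by (auto simp: C0k_real_def numeral_2_eq_2)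
  then have cont: "continuous_on S f" "continuous_on S g" for S
    by (auto intro!: continuous_at_imp_continuous_on differentiable_imp_continuous_within)
  have "bounded (g ` {-\<sigma>..\<sigma>})"
    by (intro compact_imp_bounded compact_continuous_image cont) simp
  then obtain G where G: "G > 0" and gG': "\<And>x. x \<in> {-\<sigma>..\<sigma>} \<Longrightarrow> norm (g x) \<le> G"
    unfolding bounded_pos by auto
  have gG: "g x \<le> G" for x
    using gG'[of x] supp[of x] G by (cases "\<bar>x\<bar> \<le> \<sigma>") (auto simp: abs_le_iff)
  \<comment> \<open>Half of the weighted mass of the unscaled data; \<open>\<epsilon> * m\<close> is
    the lower bound passed to \<open>life_span_bound\<close>.\<close>
  define m where "m = integral {-\<sigma>..\<sigma>} (\<lambda>x. exp x * (f x + g x)) / 2"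
  have m: "m > 0"
  proof -
    \<comment> \<open>By nonnegativity, either alternative of the hypothesis yields a point where
      the sum is nonzero.\<close>
    obtain x where x: "f x + g x \<noteq> 0" using assms(7) nonneg by (metis add_nonneg_eq_0_iff)
    then have "x \<in> {-\<sigma>..\<sigma>}" using supp[of x] by (cases "\<bar>x\<bar> \<le> \<sigma>") auto
    moreover have "continuous_on {-\<sigma>..\<sigma>} (\<lambda>x. exp x * (f x + g x))"
      by (intro continuous_intros cont)
    moreover have "0 \<le> exp x * (f x + g x)" for x using nonneg[of x] by simp
    ultimately have "integral {-\<sigma>..\<sigma>} (\<lambda>x. exp x * (f x + g x)) \<noteq> 0"
      "0 \<le> integral {-\<sigma>..\<sigma>} (\<lambda>x. exp x * (f x + g x))"
      using integral_eq_0_iff[of "-\<sigma>" \<sigma> "\<lambda>x. exp x * (f x + g x)"] x assms(3)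
      by (auto intro!: integral_nonneg integrable_continuous_real)
    then show ?thesis by (simp add: m_def)
  qed
  define Q where "Q = (m / 4) powr (1 - p) * (4 * (p / A) * (4 * exp \<sigma>) powr (p - 1)) / (p - 1)"
  have Q: "Q \<ge> 0" using p A by (simp add: Q_def)
  \<comment> \<open>The bound 1 lets the additive constant 4 be absorbed into
    \<open>4 * \<epsilon> powr (1 - p)\<close>; the other bound gives
    \<open>A / p * (\<epsilon> * g x) powr (p - 1) \<le> 1 / 2\<close>, the smallness required at
    time 0.\<close>
  define \<epsilon>0 where "\<epsilon>0 = min 1 ((p / (2 * A)) powr (1 / (p - 1)) / G)"
  have life: "T \<le> (4 + Q) * \<epsilon> powr (- (p - 1))"
    if \<epsilon>: "0 < \<epsilon>" "\<epsilon> \<le> \<epsilon>0" and T: "T > 0"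
      and sol: "classical_solution p A (\<lambda>x. \<epsilon> * f x) (\<lambda>x. \<epsilon> * g x) T v" for \<epsilon> T v
  proof -
    interpret strip_wave p A T v "dt T v" "dx v" "dt T (dt T v)" "dx (dx v)" "dx (dt T v)"
      using p A T sol by (rule classical_solution_strip_wave)
    have init: "v x 0 = \<epsilon> * f x" "dt T v x 0 = \<epsilon> * g x" for x
      using sol by (auto simp: classical_solution_def)
    have small: "A / p * \<bar>\<epsilon> * g x\<bar> powr p \<le> \<epsilon> * g x / 2" for x
    proof (cases "g x = 0")
      case False
      then have gx: "0 < \<epsilon> * g x" using nonneg[of x] \<epsilon> by simp
      have "\<epsilon> * g x \<le> \<epsilon>0 * G" using \<epsilon> gG nonneg by (intro mult_mono) auto
      also have "\<dots> \<le> (p / (2 * A)) powr (1 / (p - 1))"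
        using G by (simp add: \<epsilon>0_def min_def field_simps)
      finally have "(\<epsilon> * g x) powr (p - 1) \<le> ((p / (2 * A)) powr (1 / (p - 1))) powr (p - 1)"
        using gx p by (intro powr_mono2) auto
      also have "\<dots> = p / (2 * A)" using p A by (simp add: powr_powr)
      finally have "A / p * (\<epsilon> * g x) powr (p - 1) \<le> A / p * (p / (2 * A))"
        using A p by (intro mult_left_mono) auto
      also have "\<dots> = 1 / 2" using A p by simp
      finally have "A / p * (\<epsilon> * g x) powr (p - 1) * (\<epsilon> * g x) \<le> 1 / 2 * (\<epsilon> * g x)"
        using gx by (intro mult_right_mono) auto
      moreover have "(\<epsilon> * g x) powr p = (\<epsilon> * g x) powr (p - 1) * (\<epsilon> * g x)"
        using gx powr_add[of "\<epsilon> * g x" "p - 1" 1] by simp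
      moreover have "\<bar>\<epsilon> * g x\<bar> = \<epsilon> * g x" using gx by simp
      ultimately show ?thesis by (simp only: mult.assoc)
    qed simp
    have "T \<le> 4 + (\<epsilon> * m / 4) powr (1 - p) * (4 * (p / A) * (4 * exp \<sigma>) powr (p - 1)) / (p - 1)"
    proof (rule life_span_bound)
      have "(\<lambda>x. exp x * (v x 0 + dt T v x 0)) = (\<lambda>x. \<epsilon> * (exp x * (f x + g x)))"
        by (simp add: init algebra_simps)
      then show "\<epsilon> * m \<le> integral {-\<sigma>..\<sigma>} (\<lambda>x. exp x * (v x 0 + dt T v x 0)) / 2"
        by (simp add: m_def)
    qed (use \<epsilon> m assms(3) supp nonneg small in \<open>auto simp: init\<close>)
    also have "\<dots> = 4 + \<epsilon> powr (1 - p) * Q"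
      using \<epsilon> m by (simp add: Q_def powr_mult powr_divide)
    also have "\<dots> \<le> 4 * \<epsilon> powr (1 - p) + \<epsilon> powr (1 - p) * Q"
    proof -
      have "1 powr (1 - p) \<le> \<epsilon> powr (1 - p)"
        using \<epsilon> p by (intro powr_mono2') (auto simp: \<epsilon>0_def)
      then show ?thesis by simp
    qed
    finally show ?thesis by (simp add: algebra_simps)
  qed
  show ?thesis
  proof (intro exI conjI allI impI notI)
    show "\<epsilon>0 > 0" using G p A by (simp add: \<epsilon>0_def)
    show "4 + Q > 0" using Q by simp
    fix \<epsilon> T
    assume *: "0 < \<epsilon> \<and> \<epsilon> \<le> \<epsilon>0 \<and> (4 + Q) * \<epsilon> powr (- (p - 1)) < T"
      "\<exists>v. classical_solution p A (\<lambda>x. \<epsilon> * f x) (\<lambda>x. \<epsilon> * g x) T v"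
    \<comment> \<open>The threshold is nonnegative, so \<open>T\<close> is positive, as
      \<open>life\<close> demands.\<close>
    have "0 \<le> (4 + Q) * \<epsilon> powr (- (p - 1))" using Q by simp
    with * life[of \<epsilon> T] show False by auto
  qed
qed

end
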